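(* Let $\mathbb{F}$ be a field of characteristic not $2$, let $\eta\in\mathbb{F}\setminus\{0,1\}$, and let $A\neq 0$ be a primitive axial algebra of Jordan type $\eta$ over $\mathbb{F}$. Then $A$ admits a Frobenius form, that is, there is a non-zero bilinear form $(\cdot\,,\cdot)\colon A\times A\to\mathbb{F}$ such that $(ab,c)=(a,bc)$ for all $a,b,c\in A$, and $(a,a)=1$ for every $\eta$-axis $a\in A$.
   Context: Algebras are commutative, not necessarily associative (and not necessarily finite dimensional or unital) over a field $\mathbb{F}$ of characteristic not $2$. For $a\in A$, $\mathrm{ad}_a\colon A\to A$ is $x\mapsto xa$, and $A_\lambda(a)=\{x\in A\mid xa=\lambda x\}$ for $\lambda\in\mathbb{F}$ (possibly $0$). Fix $\eta\in\mathbb{F}\setminus\{0,1\}$. An $\eta$-axis of $A$ is a nonzero idempotent $a\in A$ such that: (1) the minimal polynomial of $\mathrm{ad}_a$ exists and divides $(x-1)x(x-\eta)$, so $A=A_1(a)\oplus A_0(a)\oplus A_\eta(a)$; (2) the fusion rules hold: $A_1(a)A_1(a)\subseteq A_1(a)$, $A_0(a)A_0(a)\subseteq A_0(a)$, $A_1(a)A_0(a)=\{0\}$, $(A_0(a)+A_1(a))A_\eta(a)\subseteq A_\eta(a)$, $A_\eta(a)^2\subseteq A_0(a)+A_1(a)$; (3) $A_1(a)=\mathbb{F}a$. A primitive axial algebra of Jordan type $\eta$ is an algebra generated by $\eta$-axes. *)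

theory Defs
  imports "HOL-Computational_Algebra.Polynomial"
begin

text \<open>
  Nonassociative (i.e. not necessarily associative) commutative algebras over a field, carried by
  a whole type. No unit and no finiteness of the dimension is assumed.
\<close>

locale comm_nonassoc_algebra = vector_space scale
  for scale :: "'f::field \<Rightarrow> 'a::ab_group_add \<Rightarrow> 'a" (infixr \<open>*s\<close> 75) +
  fixes mult :: "'a \<Rightarrow> 'a \<Rightarrow> 'a" (infixl \<open>\<bullet>\<close> 70)
  assumes mult_commute: "x \<bullet> y = y \<bullet> x"
    and mult_add_left: "(x + y) \<bullet> z = x \<bullet> z + y \<bullet> z"
    and mult_scale_left: "(c *s x) \<bullet> y = c *s (x \<bullet> y)"
begin

definition ad :: "'a \<Rightarrow> 'a \<Rightarrow> 'a" where
  "ad a = (\<lambda>x. x \<bullet> a)"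

definition eigenspace :: "'a \<Rightarrow> 'f \<Rightarrow> 'a set" where
  "eigenspace a l = {x. x \<bullet> a = l *s x}"

definition poly_map :: "'f poly \<Rightarrow> ('a \<Rightarrow> 'a) \<Rightarrow> 'a \<Rightarrow> 'a" where
  "poly_map p T = (\<lambda>x. \<Sum>i\<le>degree p. coeff p i *s (T ^^ i) x)"

definition is_minimal_polynomial :: "'f poly \<Rightarrow> ('a \<Rightarrow> 'a) \<Rightarrow> bool" where
  "is_minimal_polynomial p T \<longleftrightarrow>
     lead_coeff p = 1 \<and> (\<forall>x. poly_map p T x = 0) \<and>
     (\<forall>q. q \<noteq> 0 \<longrightarrow> (\<forall>x. poly_map q T x = 0) \<longrightarrow> degree p \<le> degree q)"

definition set_mult :: "'a set \<Rightarrow> 'a set \<Rightarrow> 'a set" where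
  "set_mult S T = {x \<bullet> y | x y. x \<in> S \<and> y \<in> T}"

definition set_sum :: "'a set \<Rightarrow> 'a set \<Rightarrow> 'a set" where
  "set_sum S T = {x + y | x y. x \<in> S \<and> y \<in> T}"

definition fusion_rules :: "'f \<Rightarrow> 'a \<Rightarrow> bool" where
  "fusion_rules \<eta> a \<longleftrightarrow>
     set_mult (eigenspace a 1) (eigenspace a 1) \<subseteq> eigenspace a 1 \<and>
     set_mult (eigenspace a 0) (eigenspace a 0) \<subseteq> eigenspace a 0 \<and>
     set_mult (eigenspace a 1) (eigenspace a 0) = {0} \<and>
     set_mult (set_sum (eigenspace a 0) (eigenspace a 1)) (eigenspace a \<eta>) \<subseteq> eigenspace a \<eta> \<and>
     set_mult (eigenspace a \<eta>) (eigenspace a \<eta>) \<subseteq> set_sum (eigenspace a 0) (eigenspace a 1)"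

definition is_axis :: "'f \<Rightarrow> 'a \<Rightarrow> bool" where
  "is_axis \<eta> a \<longleftrightarrow>
     a \<noteq> 0 \<and> a \<bullet> a = a \<and>
     (\<exists>p. is_minimal_polynomial p (ad a) \<and> p dvd [:- 1, 1:] * [:0, 1:] * [:- \<eta>, 1:]) \<and>
     fusion_rules \<eta> a \<and>
     eigenspace a 1 = range (\<lambda>c. c *s a)"

definition subalgebra :: "'a set \<Rightarrow> bool" where
  "subalgebra S \<longleftrightarrow> subspace S \<and> (\<forall>x\<in>S. \<forall>y\<in>S. x \<bullet> y \<in> S)"

text \<open>
  The algebra is generated by some set of axes if and only if it is generated by
  the set of all of its axes.
\<close>

definition is_primitive_axial_of_Jordan_type :: "'f \<Rightarrow> bool" where
  "is_primitive_axial_of_Jordan_type \<eta> \<longleftrightarrow> subalgebra hull {a. is_axis \<eta> a} = UNIV"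

definition bilinear_form :: "('a \<Rightarrow> 'a \<Rightarrow> 'f) \<Rightarrow> bool" where
  "bilinear_form B \<longleftrightarrow>
     (\<forall>x. Vector_Spaces.linear scale (*) (\<lambda>y. B x y)) \<and>
     (\<forall>y. Vector_Spaces.linear scale (*) (\<lambda>x. B x y))"

definition is_Frobenius_form :: "('a \<Rightarrow> 'a \<Rightarrow> 'f) \<Rightarrow> bool" where
  "is_Frobenius_form B \<longleftrightarrow>
     bilinear_form B \<and>
     (\<exists>x y. B x y \<noteq> 0) \<and>
     (\<forall>a b c. B (a \<bullet> b) c = B a (b \<bullet> c))"

end

end

theory Submission
  imports Defs
begin

text \<open>
  For an axis \<open>a\<close> let \<open>phi a x\<close> be the coefficient of the \<open>a\<close>-component of \<open>x\<close>, and let \<open>miyamoto a\<close>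
  be the involutory automorphism negating the \<open>\<eta>\<close>-eigenspace of \<open>a\<close>. For axes \<open>a\<close>, \<open>b\<close>,
  \<open>b \<bullet> a = phi a b *s a + (\<eta> / 2) *s (b - miyamoto a b)\<close> is a combination of axes, so the axes span the
  algebra. The key point is \<open>phi a b = phi b a\<close>: given this, extending \<open>B a x = phi a x\<close> linearly
  from a basis of axes yields a form satisfying this equation for all axes. The form is
  invariant under \<open>miyamoto a\<close>, hence the eigenspaces of \<open>a\<close> are orthogonal, that is,
  multiplication by \<open>a\<close> is self-adjoint.
\<close>

context comm_nonassoc_algebra
begin

section \<open>Bilinearity of the product and evaluation of polynomials at a map\<close>

lemma mult_add_right: "x \<bullet> (y + z) = x \<bullet> y + x \<bullet> z"
  by (metis mult_add_left mult_commute)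

lemma mult_scale_right: "x \<bullet> (c *s y) = c *s (x \<bullet> y)"
  by (metis mult_scale_left mult_commute)

lemma mult_zero_left [simp]: "0 \<bullet> x = 0"
  by (metis add_cancel_right_right mult_add_left add_0)

lemma mult_zero_right [simp]: "x \<bullet> 0 = 0"
  by (metis mult_commute mult_zero_left)

lemma mult_minus_left: "(- x) \<bullet> y = - (x \<bullet> y)"
  by (metis mult_scale_left scale_minus_left scale_one)

lemma mult_minus_right: "x \<bullet> (- y) = - (x \<bullet> y)"
  by (metis mult_commute mult_minus_left)

lemma mult_diff_left: "(x - y) \<bullet> z = x \<bullet> z - y \<bullet> z"
  by (metis diff_conv_add_uminus mult_add_left mult_minus_left)

lemma mult_diff_right: "x \<bullet> (y - z) = x \<bullet> y - x \<bullet> z"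
  by (metis mult_commute mult_diff_left)

lemmas bilinear_simps = mult_add_left mult_add_right mult_scale_left mult_scale_right
  mult_minus_left mult_minus_right mult_diff_left mult_diff_right
  scale_right_distrib scale_left_distrib scale_right_diff_distrib scale_left_diff_distrib

lemma vector_space_field: "vector_space ((*) :: 'f \<Rightarrow> 'f \<Rightarrow> 'f)"
  by unfold_locales (simp_all add: algebra_simps)

lemma linear_functional_iff:
  "Vector_Spaces.linear scale (*) f \<longleftrightarrow>
     (\<forall>x y. f (x + y) = f x + f y) \<and> (\<forall>c x. f (c *s x) = c * f x)"
  using vector_space_axioms vector_space_field by (simp add: Vector_Spaces.linear_iff)

text \<open>Padding with zero coefficients lets polynomials of different degrees be evaluated over
  one common index range.\<close>

lemma poly_map_eq_sum:
  assumes "degree p \<le> n"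
  shows "poly_map p T x = (\<Sum>i\<le>n. coeff p i *s (T ^^ i) x)"
  unfolding poly_map_def
  by (rule sum.mono_neutral_left) (use assms in \<open>auto simp: coeff_eq_0\<close>)

lemma poly_map_add: "poly_map (p + q) T x = poly_map p T x + poly_map q T x"
proof -
  define n where "n = max (degree p) (degree q)"
  have "degree p \<le> n" "degree q \<le> n" "degree (p + q) \<le> n"
    by (auto simp: n_def degree_add_le_max)
  then show ?thesis
    by (simp add: poly_map_eq_sum[of _ n] scale_left_distrib sum.distrib)
qed

lemma poly_map_smult: "poly_map (smult c p) T x = c *s poly_map p T x"
  by (simp add: poly_map_eq_sum[of "smult c p" "degree p"] poly_map_eq_sum[of p "degree p"]
      degree_smult_le scale_sum_right)

lemma poly_map_0 [simp]: "poly_map 0 T x = 0"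
  by (simp add: poly_map_def)

lemma poly_map_pCons: "poly_map (pCons c p) T x = c *s x + poly_map p T (T x)"
  by (simp add: poly_map_eq_sum[of "pCons c p" "Suc (degree p)"] degree_pCons_le
      sum.atMost_Suc_shift funpow_swap1 poly_map_def del: sum.atMost_Suc)

text \<open>Induction on the cofactor \<open>r\<close>: passing from \<open>r\<close> to
  \<open>pCons c r\<close> adds \<open>c\<close> times the value of \<open>p\<close>, and evaluates
  \<open>p * r\<close> at \<open>T x\<close> instead of \<open>x\<close>. Hence \<open>x\<close> is
  generalised.\<close>

lemma poly_map_dvd:
  assumes "p dvd q" "\<And>x. poly_map p T x = 0"
  shows "poly_map q T x = 0"
proof -
  from assms(1) obtain r where q: "q = p * r" by blast
  have "poly_map (p * r) T x = 0" for x
    by (induction r arbitrary: x)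
      (simp_all add: poly_map_add poly_map_smult poly_map_pCons assms(2))
  then show ?thesis by (simp add: q)
qed

end

section \<open>Eigenspace decomposition with respect to an axis\<close>

locale jordan_type_algebra = comm_nonassoc_algebra scale mult
  for scale :: "'f::field \<Rightarrow> 'a::ab_group_add \<Rightarrow> 'a" (infixr \<open>*s\<close> 75)
    and mult :: "'a \<Rightarrow> 'a \<Rightarrow> 'a" (infixl \<open>\<bullet>\<close> 70) +
  fixes \<eta> :: 'f
  assumes two_nz: "(2::'f) \<noteq> 0" and eta_nz: "\<eta> \<noteq> 0" and eta_neq_1: "\<eta> \<noteq> 1"
begin

text \<open>The three summands are the components for the eigenvalues 1, 0 and \<eta>. By
  primitivity the first is a multiple of \<open>a\<close>, so only its coefficient is
  recorded.\<close>

definition decomp :: "'a \<Rightarrow> 'a \<Rightarrow> 'f \<Rightarrow> 'a \<Rightarrow> 'a \<Rightarrow> bool" where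
  "decomp a x c v w \<longleftrightarrow> x = c *s a + v + w \<and> v \<bullet> a = 0 \<and> w \<bullet> a = \<eta> *s w"

text \<open>Unlike \<^term>\<open>is_axis \<eta>\<close>, this does not mention minimal polynomials, so that it is
  easily seen to be invariant under automorphisms.\<close>

definition splitting_axis :: "'a \<Rightarrow> bool" where
  "splitting_axis a \<longleftrightarrow> a \<noteq> 0 \<and> a \<bullet> a = a \<and> (\<forall>x. \<exists>c v w. decomp a x c v w) \<and>
     (\<forall>v v'. v \<bullet> a = 0 \<longrightarrow> v' \<bullet> a = 0 \<longrightarrow> (v \<bullet> v') \<bullet> a = 0) \<and>
     (\<forall>v w. v \<bullet> a = 0 \<longrightarrow> w \<bullet> a = \<eta> *s w \<longrightarrow> (v \<bullet> w) \<bullet> a = \<eta> *s (v \<bullet> w)) \<and>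
     (\<forall>w w'. w \<bullet> a = \<eta> *s w \<longrightarrow> w' \<bullet> a = \<eta> *s w' \<longrightarrow> (\<exists>c v. w \<bullet> w' = c *s a + v \<and> v \<bullet> a = 0))"

text \<open>The polynomial \<open>(t - 1) * t * (t - \<eta>)\<close> annihilates \<open>ad a\<close>
  and has distinct roots, so Lagrange interpolation gives explicit projections onto the
  eigenspaces.\<close>

lemma is_axis_imp_splitting_axis:
  assumes "is_axis \<eta> a"
  shows "splitting_axis a"
proof -
  obtain p where p: "is_minimal_polynomial p (ad a)" "p dvd [:- 1, 1:] * [:0, 1:] * [:- \<eta>, 1:]"
    and aa: "a \<bullet> a = a" and nz: "a \<noteq> 0" and fus: "fusion_rules \<eta> a"
    and prim: "eigenspace a 1 = range (\<lambda>c. c *s a)"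
    using assms by (auto simp: is_axis_def)
  have "poly_map ([:- 1, 1:] * [:0, 1:] * [:- \<eta>, 1:]) (ad a) x = 0" for x
    using poly_map_dvd[OF p(2)] p(1) by (simp add: is_minimal_polynomial_def)
  then have cubic: "x \<bullet> a \<bullet> a \<bullet> a = x \<bullet> a \<bullet> a + \<eta> *s (x \<bullet> a \<bullet> a) - \<eta> *s (x \<bullet> a)" for x
    by (simp add: poly_map_pCons ad_def bilinear_simps algebra_simps add_eq_0_iff)
  have "\<exists>c v w. decomp a x c v w" for x
  proof -
    define y where "y = x \<bullet> a"
    define z where "z = y \<bullet> a"
    have za: "z \<bullet> a = z + \<eta> *s z - \<eta> *s y" using cubic[of x] by (simp add: y_def z_def)
    define k where "k = inverse (\<eta> * (1 - \<eta>))"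
    have k: "k * (\<eta> * (1 - \<eta>)) = 1" using eta_nz eta_neq_1 unfolding k_def by (intro left_inverse) simp
    \<comment> \<open>Writing \<open>T\<close> for \<open>ad a\<close>, these are the Lagrange
      projections: \<open>v\<close> is \<open>(T - 1)(T - \<eta>) x / \<eta>\<close> and
      \<open>w\<close> is \<open>T (T - 1) x / (\<eta> (\<eta> - 1))\<close>. The remaining one,
      \<open>T (T - \<eta>) x / (1 - \<eta>)\<close>, is a multiple of
      \<open>z - \<eta> *s y\<close>.\<close>
    define v where "v = (k * (1 - \<eta>)) *s (z - y - \<eta> *s y + \<eta> *s x)"
    define w where "w = (- k) *s (z - y)"
    have "(z - \<eta> *s y) \<in> eigenspace a 1"
      by (simp add: eigenspace_def bilinear_simps za flip: z_def)
    then obtain c where c: "z - \<eta> *s y = c *s a" using prim by blast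
    \<comment> \<open>The three projections sum to the identity; here with the denominator
      \<open>\<eta> * (1 - \<eta>)\<close> cleared.\<close>
    have "\<eta> *s (z - \<eta> *s y) + (1 - \<eta>) *s (z - y - \<eta> *s y + \<eta> *s x) - (z - y) = (\<eta> * (1 - \<eta>)) *s x"
      by (simp add: bilinear_simps algebra_simps)
    then have "k *s (\<eta> *s (z - \<eta> *s y) + (1 - \<eta>) *s (z - y - \<eta> *s y + \<eta> *s x) - (z - y)) = x"
      using k by simp
    then have "x = k *s \<eta> *s (z - \<eta> *s y) + v - k *s (z - y)"
      unfolding v_def scale_scale[symmetric]
      by (metis scale_right_distrib scale_right_diff_distrib)
    then have "x = (k * \<eta> * c) *s a + v + w"
      by (simp add: w_def c mult.assoc)
    moreover have "(z - y - \<eta> *s y + \<eta> *s x) \<bullet> a = 0" "(z - y) \<bullet> a = \<eta> *s (z - y)"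
      by (simp_all add: bilinear_simps za flip: z_def y_def)
    then have "v \<bullet> a = 0" "w \<bullet> a = \<eta> *s w"
      by (simp_all add: v_def w_def mult_scale_left mult_minus_left mult.commute)
    ultimately show ?thesis unfolding decomp_def by blast
  qed
  moreover have "(v \<bullet> v') \<bullet> a = 0" if "v \<bullet> a = 0" "v' \<bullet> a = 0" for v v'
  proof -
    have "v \<in> eigenspace a 0" "v' \<in> eigenspace a 0" using that by (simp_all add: eigenspace_def)
    then have "v \<bullet> v' \<in> set_mult (eigenspace a 0) (eigenspace a 0)"
      unfolding set_mult_def by blast
    then have "v \<bullet> v' \<in> eigenspace a 0" using fus by (auto simp: fusion_rules_def)
    then show ?thesis by (simp add: eigenspace_def)
  qed
  moreover have "(v \<bullet> w) \<bullet> a = \<eta> *s (v \<bullet> w)" if "v \<bullet> a = 0" "w \<bullet> a = \<eta> *s w" for v w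
  proof -
    have "v \<in> set_sum (eigenspace a 0) (eigenspace a 1)"
      unfolding set_sum_def eigenspace_def using that
      by (intro CollectI exI[of _ v] exI[of _ 0]) simp
    moreover have "w \<in> eigenspace a \<eta>" using that by (simp add: eigenspace_def)
    ultimately have "v \<bullet> w \<in> eigenspace a \<eta>"
      using fus unfolding fusion_rules_def set_mult_def by blast
    then show ?thesis by (simp add: eigenspace_def)
  qed
  moreover have "\<exists>c v. w \<bullet> w' = c *s a + v \<and> v \<bullet> a = 0"
    if "w \<bullet> a = \<eta> *s w" "w' \<bullet> a = \<eta> *s w'" for w w'
  proof -
    have "w \<bullet> w' \<in> set_sum (eigenspace a 0) (eigenspace a 1)"
      using fus that unfolding fusion_rules_def set_mult_def eigenspace_def by blast
    then obtain v u where "w \<bullet> w' = v + u" "v \<bullet> a = 0" "u \<in> range (\<lambda>c. c *s a)"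
      unfolding set_sum_def prim by (auto simp: eigenspace_def)
    then show ?thesis by (metis add.commute rangeE)
  qed
  ultimately show ?thesis using aa nz unfolding splitting_axis_def by blast
qed

lemma splitting_axisD:
  assumes "splitting_axis a"
  shows splitting_axis_nz: "a \<noteq> 0"
    and splitting_axis_idem: "a \<bullet> a = a"
    and splitting_axis_decomp: "\<exists>c v w. decomp a x c v w"
    and splitting_axis_fusion_00: "\<lbrakk>v \<bullet> a = 0; v' \<bullet> a = 0\<rbrakk> \<Longrightarrow> (v \<bullet> v') \<bullet> a = 0"
    and splitting_axis_fusion_0\<eta>:
      "\<lbrakk>v \<bullet> a = 0; w \<bullet> a = \<eta> *s w\<rbrakk> \<Longrightarrow> (v \<bullet> w) \<bullet> a = \<eta> *s (v \<bullet> w)"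
    and splitting_axis_fusion_\<eta>\<eta>:
      "\<lbrakk>w \<bullet> a = \<eta> *s w; w' \<bullet> a = \<eta> *s w'\<rbrakk> \<Longrightarrow> \<exists>c v. w \<bullet> w' = c *s a + v \<and> v \<bullet> a = 0"
  using assms unfolding splitting_axis_def by blast+

lemma decomp_add:
  "\<lbrakk>decomp a x c v w; decomp a y d v' w'\<rbrakk> \<Longrightarrow> decomp a (x + y) (c + d) (v + v') (w + w')"
  by (simp add: decomp_def bilinear_simps algebra_simps)

lemma decomp_scale: "decomp a x c v w \<Longrightarrow> decomp a (k *s x) (k * c) (k *s v) (k *s w)"
  by (simp add: decomp_def bilinear_simps mult.commute)

text \<open>Multiplying by \<open>a\<close> once and twice gives
  \<open>c *s a + \<eta> *s w = 0\<close> and \<open>c *s a + \<eta>^2 *s w = 0\<close>. Since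
  \<eta> is neither 0 nor 1, their difference forces \<open>w = 0\<close>.\<close>

lemma decomp_zero:
  assumes a: "splitting_axis a" and "decomp a 0 c v w"
  shows "c = 0 \<and> v = 0 \<and> w = 0"
proof -
  note aa = splitting_axis_idem[OF a]
  have 0: "0 = c *s a + v + w" and v: "v \<bullet> a = 0" and w: "w \<bullet> a = \<eta> *s w"
    using assms by (auto simp: decomp_def)
  have "(c *s a + v + w) \<bullet> a = 0" by (simp flip: 0)
  then have 1: "c *s a + \<eta> *s w = 0" by (simp add: bilinear_simps aa v w)
  then have "(c *s a + \<eta> *s w) \<bullet> a = 0" by simp
  then have "c *s a + \<eta> *s (\<eta> *s w) = 0" by (simp add: bilinear_simps aa w)
  with 1 have "\<eta> *s (\<eta> *s w) = \<eta> *s w" by (metis add_left_cancel)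
  then have "w = 0" using eta_nz eta_neq_1 scale_cancel_right[of \<eta> w 1] by simp
  with 1 have "c = 0" using splitting_axis_nz[OF a] by simp
  with 0 \<open>w = 0\<close> show ?thesis by simp
qed

lemma decomp_unique:
  assumes a: "splitting_axis a" and "decomp a x c v w" "decomp a x d v' w'"
  shows "c = d" "v = v'" "w = w'"
proof -
  have "decomp a (x + (-1) *s x) (c + (-1) * d) (v + (-1) *s v') (w + (-1) *s w')"
    by (intro decomp_add decomp_scale assms)
  then have "decomp a 0 (c - d) (v - v') (w - w')" by simp
  from decomp_zero[OF a this] show "c = d" "v = v'" "w = w'" by simp_all
qed

section \<open>Projection coefficients and Miyamoto involutions\<close>

definition phi :: "'a \<Rightarrow> 'a \<Rightarrow> 'f" where
  "phi a x = (THE c. \<exists>v w. decomp a x c v w)"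

definition miyamoto :: "'a \<Rightarrow> 'a \<Rightarrow> 'a" where
  "miyamoto a x = (THE y. \<exists>c v w. decomp a x c v w \<and> y = c *s a + v - w)"

lemma phi_eq:
  assumes "splitting_axis a" "decomp a x c v w"
  shows "phi a x = c"
  unfolding phi_def using assms decomp_unique(1)[OF assms(1)] by blast

lemma miyamoto_eq:
  assumes "splitting_axis a" "decomp a x c v w"
  shows "miyamoto a x = c *s a + v - w"
  unfolding miyamoto_def
  by (rule the_equality) (use assms decomp_unique[OF assms(1) assms(2)] in blast)+

lemma phi_add: "splitting_axis a \<Longrightarrow> phi a (x + y) = phi a x + phi a y"
  by (metis decomp_add phi_eq splitting_axis_decomp)

lemma phi_scale: "splitting_axis a \<Longrightarrow> phi a (k *s x) = k * phi a x"
  by (metis decomp_scale phi_eq splitting_axis_decomp)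

lemma phi_self: "splitting_axis a \<Longrightarrow> phi a a = 1"
  by (rule phi_eq[where v = 0 and w = 0]) (simp_all add: decomp_def)

lemma miyamoto_add:
  assumes a: "splitting_axis a"
  shows "miyamoto a (x + y) = miyamoto a x + miyamoto a y"
proof -
  obtain c v w d v' w' where x: "decomp a x c v w" and y: "decomp a y d v' w'"
    using splitting_axis_decomp[OF a] by meson
  show ?thesis
    by (simp add: miyamoto_eq[OF a x] miyamoto_eq[OF a y] miyamoto_eq[OF a decomp_add[OF x y]]
        bilinear_simps)
qed

lemma miyamoto_scale:
  assumes a: "splitting_axis a"
  shows "miyamoto a (k *s x) = k *s miyamoto a x"
proof -
  obtain c v w where x: "decomp a x c v w"
    using splitting_axis_decomp[OF a] by meson
  show ?thesis
    by (simp add: miyamoto_eq[OF a x] miyamoto_eq[OF a decomp_scale[OF x]] bilinear_simps)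
qed

lemma miyamoto_involution:
  assumes a: "splitting_axis a"
  shows "miyamoto a (miyamoto a x) = x"
proof -
  obtain c v w where x: "decomp a x c v w"
    using splitting_axis_decomp[OF a] by meson
  then have "decomp a (miyamoto a x) c v (- w)"
    unfolding miyamoto_eq[OF a x] by (simp add: decomp_def mult_minus_left)
  from miyamoto_eq[OF a this] have "miyamoto a (miyamoto a x) = c *s a + v + w" by simp
  also have "\<dots> = x" using x by (simp add: decomp_def)
  finally show ?thesis .
qed

text \<open>The fusion rules make the algebra graded by Z/2, with even part the sum of the 1- and
  0-eigenspaces and odd part the \<eta>-eigenspace; the involution is the sign map of this
  grading.\<close>

lemma miyamoto_mult:
  assumes a: "splitting_axis a"
  shows "miyamoto a (x \<bullet> y) = miyamoto a x \<bullet> miyamoto a y"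
proof -
  obtain c v w d v' w' where x: "decomp a x c v w" and y: "decomp a y d v' w'"
    using splitting_axis_decomp[OF a] by meson
  have v: "v \<bullet> a = 0" "v' \<bullet> a = 0" "w \<bullet> a = \<eta> *s w" "w' \<bullet> a = \<eta> *s w'"
    and xy: "x = c *s a + v + w" "y = d *s a + v' + w'"
    using x y by (auto simp: decomp_def)
  have v': "a \<bullet> v = 0" "a \<bullet> v' = 0" "a \<bullet> w = \<eta> *s w" "a \<bullet> w' = \<eta> *s w'"
    using v mult_commute by metis+
  obtain e u where ww: "w \<bullet> w' = e *s a + u" "u \<bullet> a = 0"
    using splitting_axis_fusion_\<eta>\<eta>[OF a v(3,4)] by blast
  have vw: "v \<bullet> w' \<bullet> a = \<eta> *s (v \<bullet> w')" "w \<bullet> v' \<bullet> a = \<eta> *s (w \<bullet> v')"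
    using splitting_axis_fusion_0\<eta>[OF a] v mult_commute by metis+
  \<comment> \<open>The odd part of the product collects the mixed terms. The even product
    \<open>w \<bullet> w'\<close> contributes \<open>e\<close> and \<open>u\<close> to the other two
    components.\<close>
  have "decomp a (x \<bullet> y) (c * d + e) (v \<bullet> v' + u)
      (c *s \<eta> *s w' + d *s \<eta> *s w + v \<bullet> w' + w \<bullet> v')"
    using splitting_axis_fusion_00[OF a v(1,2)]
    by (simp add: decomp_def xy bilinear_simps v v' vw ww splitting_axis_idem[OF a] algebra_simps)
  then show ?thesis
    by (simp add: miyamoto_eq[OF a x] miyamoto_eq[OF a y] miyamoto_eq[OF a]
        bilinear_simps v v' ww splitting_axis_idem[OF a] algebra_simps)
qed

section \<open>Transport of axes along involutory automorphisms\<close>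

context
  fixes g :: "'a \<Rightarrow> 'a"
  assumes g_add: "\<And>x y. g (x + y) = g x + g y"
    and g_scale: "\<And>c x. g (c *s x) = c *s g x"
    and g_mult: "\<And>x y. g (x \<bullet> y) = g x \<bullet> g y"
    and g_invol: "\<And>x. g (g x) = x"
begin

lemma automorphism_zero: "g 0 = 0"
  by (metis g_scale scale_zero_left)

lemma automorphism_decomp:
  "decomp a x c v w \<Longrightarrow> decomp (g a) (g x) c (g v) (g w)"
  unfolding decomp_def by (metis g_add g_scale g_mult automorphism_zero)

lemma automorphism_eigen: "v \<bullet> g a = l *s v \<longleftrightarrow> g v \<bullet> a = l *s g v"
  by (metis g_scale g_mult g_invol)

lemma automorphism_eigen_0: "v \<bullet> g a = 0 \<longleftrightarrow> g v \<bullet> a = 0"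
  using automorphism_eigen[of v a 0] by simp

text \<open>Since \<open>g\<close> is its own inverse, each condition on \<open>g a\<close> is
  pulled back by \<open>g\<close> to the same condition on \<open>a\<close>.\<close>

lemma automorphism_splitting_axis:
  assumes a: "splitting_axis a"
  shows "splitting_axis (g a)"
proof -
  have "\<exists>c v w. decomp (g a) x c v w" for x
    using splitting_axis_decomp[OF a, of "g x"] automorphism_decomp[of a "g x"] g_invol[of x]
    by metis
  moreover have "\<exists>c v. w \<bullet> w' = c *s g a + v \<and> v \<bullet> g a = 0"
    if "w \<bullet> g a = \<eta> *s w" "w' \<bullet> g a = \<eta> *s w'" for w w'
  proof -
    obtain c v where "g w \<bullet> g w' = c *s a + v" "v \<bullet> a = 0"
      using splitting_axis_fusion_\<eta>\<eta>[OF a] \<open>w \<bullet> g a = \<eta> *s w\<close> \<open>w' \<bullet> g a = \<eta> *s w'\<close>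
      unfolding automorphism_eigen by meson
    then have "w \<bullet> w' = c *s g a + g v" "g v \<bullet> g a = 0"
      by (metis g_add g_scale g_mult g_invol automorphism_zero)+
    then show ?thesis by blast
  qed
  moreover have "g a \<noteq> 0" "g a \<bullet> g a = g a"
    using a by (metis g_mult g_invol automorphism_zero splitting_axis_nz splitting_axis_idem)+
  ultimately show ?thesis
    using splitting_axis_fusion_00[OF a] splitting_axis_fusion_0\<eta>[OF a]
    unfolding splitting_axis_def automorphism_eigen automorphism_eigen_0 g_mult by blast
qed

lemma automorphism_phi:
  assumes a: "splitting_axis a"
  shows "phi (g a) (g x) = phi a x"
  using splitting_axis_decomp[OF a, of x] phi_eq[OF a] automorphism_decomp
    phi_eq[OF automorphism_splitting_axis[OF a]] by metis

end

lemma miyamoto_splitting_axis: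
  "\<lbrakk>splitting_axis a; splitting_axis b\<rbrakk> \<Longrightarrow> splitting_axis (miyamoto a b)"
  by (rule automorphism_splitting_axis)
    (simp_all add: miyamoto_add miyamoto_scale miyamoto_mult miyamoto_involution)

lemma phi_miyamoto:
  "\<lbrakk>splitting_axis a; splitting_axis b\<rbrakk> \<Longrightarrow> phi (miyamoto a b) (miyamoto a x) = phi b x"
  by (rule automorphism_phi)
    (simp_all add: miyamoto_add miyamoto_scale miyamoto_mult miyamoto_involution)

section \<open>Axes span the algebra\<close>

lemma mult_axis_eq:
  assumes a: "splitting_axis a"
  shows "x \<bullet> a = phi a x *s a + (\<eta> / 2) *s (x - miyamoto a x)"
proof -
  obtain c v w where x: "decomp a x c v w"
    using splitting_axis_decomp[OF a] by meson
  \<comment> \<open>The involution changes only the sign of \<open>w\<close>, so the difference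
    isolates \<open>2 *s w\<close>; multiplication by \<open>a\<close> kills \<open>v\<close> and
    scales \<open>w\<close> by \<eta>.\<close>
  then have "x - miyamoto a x = c *s a + v + w - (c *s a + v - w)"
    using miyamoto_eq[OF a x] unfolding decomp_def by metis
  also have "\<dots> = w + w" by simp
  also have "\<dots> = 2 *s w" by (metis one_add_one scale_left_distrib scale_one)
  finally have "(\<eta> / 2) *s (x - miyamoto a x) = \<eta> *s w" using two_nz by simp
  then show ?thesis
    using x by (simp add: phi_eq[OF a x]) (simp add: decomp_def bilinear_simps splitting_axis_idem[OF a])
qed

text \<open>Linearity in each factor reduces closure to the product of two axes, where every term of
  \<open>mult_axis_eq\<close> is a multiple of an axis.\<close>

lemma subalgebra_span_axes: "subalgebra (span {a. splitting_axis a})"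
proof -
  let ?S = "span {a. splitting_axis a}"
  have ax: "x \<bullet> a \<in> ?S" if a: "splitting_axis a" and "x \<in> ?S" for a x
    using \<open>x \<in> ?S\<close>
  proof (induction rule: span_induct_alt)
    case base
    then show ?case by (simp add: span_zero)
  next
    case (step c b y)
    then have "a \<in> ?S" "b \<in> ?S" "miyamoto a b \<in> ?S"
      using a miyamoto_splitting_axis[OF a, of b] by (simp_all add: span_base)
    then have "b \<bullet> a \<in> ?S"
      unfolding mult_axis_eq[OF a] by (intro span_add span_scale span_diff)
    with step show ?case by (simp add: bilinear_simps span_add span_scale)
  qed
  have "x \<bullet> y \<in> ?S" if "x \<in> ?S" "y \<in> ?S" for x y
    using \<open>y \<in> ?S\<close>
  proof (induction rule: span_induct_alt)
    case base
    then show ?case by (simp add: span_zero)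
  next
    case (step c b y)
    with ax[of b x] \<open>x \<in> ?S\<close> show ?case by (simp add: bilinear_simps span_add span_scale)
  qed
  then show ?thesis by (simp add: subalgebra_def subspace_span)
qed

lemma span_axes:
  assumes "is_primitive_axial_of_Jordan_type \<eta>"
  shows "span {a. splitting_axis a} = UNIV"
proof -
  have "subalgebra hull {a. is_axis \<eta> a} \<subseteq> span {a. splitting_axis a}"
  proof (rule hull_minimal)
    show "{a. is_axis \<eta> a} \<subseteq> span {a. splitting_axis a}"
      by (auto intro: span_base is_axis_imp_splitting_axis)
    show "subalgebra (span {a. splitting_axis a})" by (rule subalgebra_span_axes)
  qed
  then show ?thesis using assms by (auto simp: is_primitive_axial_of_Jordan_type_def)
qed

section \<open>Symmetry of \<open>phi\<close> on pairs of axes\<close>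

lemma seress:
  assumes a: "splitting_axis a" and v: "v \<bullet> a = 0"
  shows "(x \<bullet> (k *s a + v)) \<bullet> a = (x \<bullet> a) \<bullet> (k *s a + v)"
proof -
  obtain c u w where "decomp a x c u w"
    using splitting_axis_decomp[OF a] by meson
  then have x: "x = c *s a + u + w" "u \<bullet> a = 0" "w \<bullet> a = \<eta> *s w"
    by (auto simp: decomp_def)
  \<comment> \<open>By the fusion rules, multiplication by \<open>k *s a + v\<close> maps each
    eigenspace of \<open>a\<close> into itself, so it commutes with multiplication by
    \<open>a\<close>.\<close>
  have "a \<bullet> v = 0" "u \<bullet> v \<bullet> a = 0" "w \<bullet> v \<bullet> a = \<eta> *s (w \<bullet> v)"
    using splitting_axis_fusion_00[OF a] splitting_axis_fusion_0\<eta>[OF a] v x mult_commute by metis+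
  then show ?thesis by (simp add: x bilinear_simps splitting_axis_idem[OF a])
qed

text \<open>Both \<open>a \<bullet> b\<close> and \<open>\<eta> *s b\<close> have \<eta>-component
  \<open>\<eta> *s w\<close>, so these cancel in \<open>s\<close>. Thus \<open>s\<close> has the
  form required by \<open>seress\<close>, and \<open>s \<bullet> a\<close> is a multiple of
  \<open>a\<close>. As \<open>s\<close> is symmetric in \<open>a\<close> and \<open>b\<close>, the
  same can be used with the axes exchanged.\<close>

lemma seress_sigma:
  fixes a b :: 'a
  assumes a: "splitting_axis a"
  defines "s \<equiv> a \<bullet> b - \<eta> *s a - \<eta> *s b"
  shows "s \<bullet> a = ((1 - \<eta>) * phi a b - \<eta>) *s a" "(b \<bullet> s) \<bullet> a = (b \<bullet> a) \<bullet> s"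
proof -
  obtain c v w where d: "decomp a b c v w"
    using splitting_axis_decomp[OF a] by meson
  then have b: "b = c *s a + v + w" "v \<bullet> a = 0" "w \<bullet> a = \<eta> *s w"
    by (auto simp: decomp_def)
  have "a \<bullet> v = 0" "a \<bullet> w = \<eta> *s w" using b mult_commute by metis+
  then have s: "s = ((1 - \<eta>) * c - \<eta>) *s a + (- \<eta>) *s v"
    by (simp add: s_def b(1) bilinear_simps splitting_axis_idem[OF a] algebra_simps)
  show "s \<bullet> a = ((1 - \<eta>) * phi a b - \<eta>) *s a"
    unfolding phi_eq[OF a d]
    by (simp add: s mult_add_left mult_diff_left mult_scale_left splitting_axis_idem[OF a] b(2))
  have "((- \<eta>) *s v) \<bullet> a = 0" by (simp only: mult_scale_left b(2) scale_zero_right)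
  from seress[OF a this] show "(b \<bullet> s) \<bullet> a = (b \<bullet> a) \<bullet> s" by (simp only: s)
qed

lemma phi_eq_0:
  assumes "splitting_axis a" "x \<bullet> a = 0"
  shows "phi a x = 0"
  by (rule phi_eq[where v = x and w = 0]) (simp_all add: assms decomp_def)

lemma phi_eq_0_\<eta>:
  assumes "splitting_axis a" "x \<bullet> a = \<eta> *s x"
  shows "phi a x = 0"
  by (rule phi_eq[where v = 0 and w = x]) (simp_all add: assms decomp_def)

text \<open>With \<open>s = a \<bullet> b - \<eta> *s a - \<eta> *s b\<close>, \<open>(b \<bullet> s) \<bullet> a = (a \<bullet> b) \<bullet> s = (a \<bullet> s) \<bullet> b\<close>, so the
  eigenvalues of \<open>a\<close> and \<open>b\<close> under multiplication by \<open>s\<close> agree unless \<open>a \<bullet> b = 0\<close>.\<close>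

lemma phi_commute:
  assumes a: "splitting_axis a" and b: "splitting_axis b"
  shows "phi a b = phi b a"
proof (cases "a \<bullet> b = 0")
  case True
  then have "phi a b = 0" "phi b a = 0"
    using phi_eq_0[OF a, of b] phi_eq_0[OF b, of a] by (simp_all add: mult_commute)
  then show ?thesis by simp
next
  case False
  define s where "s = a \<bullet> b - \<eta> *s a - \<eta> *s b"
  have s': "s = b \<bullet> a - \<eta> *s b - \<eta> *s a"
    by (simp add: s_def mult_commute algebra_simps)
  note 1 = seress_sigma[OF a, of b, folded s_def]
  note 2 = seress_sigma[OF b, of a, folded s']
  have "((1 - \<eta>) * phi b a - \<eta>) *s (a \<bullet> b) = (b \<bullet> s) \<bullet> a"
    using 2(1) by (simp only: mult_commute[of b s] mult_scale_left mult_commute[of b a])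
  also have "\<dots> = (a \<bullet> s) \<bullet> b"
    by (simp only: 1(2) 2(2) mult_commute[of b a])
  also have "\<dots> = ((1 - \<eta>) * phi a b - \<eta>) *s (a \<bullet> b)"
    using 1(1) by (simp only: mult_commute[of a s] mult_scale_left)
  \<comment> \<open>As \<open>a \<bullet> b\<close> is nonzero the two scalars agree, and
    \<open>1 - \<eta>\<close> can be cancelled.\<close>
  finally show ?thesis using False eta_neq_1 by simp
qed

section \<open>Construction of the form from a basis of axes\<close>

context
  assumes spanning: "span {a. splitting_axis a} = UNIV"
begin

lemma axes_induct [case_names zero step]:
  assumes "P 0" "\<And>c a y. splitting_axis a \<Longrightarrow> P y \<Longrightarrow> P (c *s a + y)"
  shows "P x"
  by (rule span_induct_alt[of x "{a. splitting_axis a}"]) (use assms spanning in auto)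

lemma exists_form:
  obtains B where "bilinear_form B" "\<And>a x. splitting_axis a \<Longrightarrow> B a x = phi a x"
proof -
  have pair: "vector_space_pair scale ((*) :: 'f \<Rightarrow> 'f \<Rightarrow> 'f)"
    by (intro vector_space_pair.intro vector_space_axioms vector_space_field)
  obtain S where S: "S \<subseteq> {a. splitting_axis a}" "independent S" "{a. splitting_axis a} \<subseteq> span S"
    using maximal_independent_subset by blast
  have UN: "span S = UNIV"
    using span_minimal[OF S(3) subspace_span] spanning by auto
  have S_axis: "splitting_axis a" if "a \<in> S" for a using S(1) that by blast
  have ex: "\<exists>f. Vector_Spaces.linear scale (*) f \<and> (\<forall>a\<in>S. f a = phi a y)" for y
    by (rule vector_space_pair.linear_independent_extend[OF pair S(2)])
  \<comment> \<open>The functional \<open>f y\<close> will be the form with second argument fixed to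
    \<open>y\<close>: its values on the basis \<open>S\<close> are prescribed by \<open>phi\<close>.
    Linearity in \<open>y\<close> is inherited from that of each \<open>phi a\<close>.\<close>
  define f where "f y = (SOME f. Vector_Spaces.linear scale (*) f \<and> (\<forall>a\<in>S. f a = phi a y))" for y
  have f: "Vector_Spaces.linear scale (*) (f y)" and fS: "\<And>a. a \<in> S \<Longrightarrow> f y a = phi a y" for y
    using someI_ex[OF ex[of y]] unfolding f_def by blast+
  have f_simps: "f y (u + v) = f y u + f y v" "f y (c *s u) = c * f y u" "f y 0 = 0" for y u v c
    using f[of y] linear_functional_iff[of "f y"] vector_space_pair.linear_0[OF pair f[of y]] by simp_all
  have S_induct: "P x" if "P 0" "\<And>c a y. a \<in> S \<Longrightarrow> P y \<Longrightarrow> P (c *s a + y)" for P x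
  proof (rule span_induct_alt[of x S])
    show "x \<in> span S" using UN by simp
  qed (fact that)+
  have phi_0: "phi a 0 = 0" if "splitting_axis a" for a
    using phi_eq_0[OF that, of 0] by simp
  have f_add: "f (y + z) x = f y x + f z x" for x y z
    by (induction x rule: S_induct) (simp_all add: f_simps fS S_axis phi_add algebra_simps)
  have f_scale: "f (k *s y) x = k * f y x" for x y k
    by (induction x rule: S_induct) (simp_all add: f_simps fS S_axis phi_scale algebra_simps)
  have f_0: "f 0 x = 0" for x using f_scale[of 0 0 x] by simp
  \<comment> \<open>On a basis axis \<open>b\<close> the prescribed value is \<open>phi b a\<close>,
    which symmetry turns into \<open>phi a b\<close>; both sides are linear in
    \<open>x\<close>.\<close>
  have fS': "f a x = phi a x" if a: "a \<in> S" for a x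
    by (induction x rule: S_induct)
      (simp_all add: f_simps fS S_axis phi_0 phi_add phi_scale phi_commute[of _ a] a)
  \<comment> \<open>Here \<open>a\<close> need not lie in \<open>S\<close>. Expanding
    \<open>x\<close> instead leaves terms \<open>f b a\<close> with \<open>b\<close> in
    \<open>S\<close>, to which the previous fact applies, again followed by symmetry.\<close>
  have "f x a = phi a x" if a: "splitting_axis a" for a x
    by (induction x rule: S_induct)
      (simp_all add: f_add f_scale f_0 fS' S_axis phi_0 phi_add phi_scale phi_commute[of _ a] a)
  moreover have "bilinear_form (\<lambda>x y. f y x)"
    unfolding bilinear_form_def linear_functional_iff by (simp add: f_add f_scale f_simps)
  ultimately show ?thesis using that by blast
qed

section \<open>Invariance and associativity of the form\<close>

context
  fixes B :: "'a \<Rightarrow> 'a \<Rightarrow> 'f"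
  assumes bilin: "bilinear_form B"
    and B_axis: "\<And>a x. splitting_axis a \<Longrightarrow> B a x = phi a x"
begin

lemma form_simps:
  "B (x + y) z = B x z + B y z" "B x (y + z) = B x y + B x z"
  "B (c *s x) y = c * B x y" "B x (c *s y) = c * B x y"
  using bilin unfolding bilinear_form_def linear_functional_iff by blast+

lemma form_zero: "B 0 x = 0" "B x 0 = 0"
  using form_simps(3)[of 0 0 x] form_simps(4)[of x 0 0] by simp_all

lemma form_axis_right:
  assumes "splitting_axis a"
  shows "B x a = phi a x"
  by (induction x rule: axes_induct)
    (simp_all add: assms form_simps form_zero B_axis phi_add phi_scale phi_eq_0 phi_commute[of _ a])

text \<open>By linearity \<open>x\<close> may be taken to be an axis \<open>b\<close>. Its image is
  again an axis, so both sides are values of \<open>phi\<close>, which automorphisms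
  preserve.\<close>

lemma form_miyamoto:
  assumes "splitting_axis a"
  shows "B (miyamoto a x) (miyamoto a y) = B x y"
proof (induction x rule: axes_induct)
  case zero
  have "miyamoto a 0 = 0" using miyamoto_scale[OF assms, of 0 0] by simp
  then show ?case by (simp add: form_simps form_zero)
next
  case (step c b y)
  then show ?case using assms
    by (simp add: form_simps form_zero miyamoto_add miyamoto_scale B_axis phi_miyamoto miyamoto_splitting_axis)
qed

text \<open>The involution fixes \<open>v\<close> and negates \<open>w\<close>, so invariance makes
  each value equal to its own negative; 2 is invertible.\<close>

lemma form_orthogonal:
  assumes a: "splitting_axis a" and v: "v \<bullet> a = 0" and w: "w \<bullet> a = \<eta> *s w"
  shows "B v w = 0" "B w v = 0"
proof -
  have "decomp a v 0 v 0" "decomp a w 0 0 w" using v w by (simp_all add: decomp_def)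
  then have m: "miyamoto a v = v" "miyamoto a w = (-1) *s w"
    by (simp_all add: miyamoto_eq[OF a])
  have "2 * B v w = 0" "2 * B w v = 0"
    using form_miyamoto[OF a, of v w] form_miyamoto[OF a, of w v]
    unfolding m form_simps mult_2 by (metis add.left_inverse mult_minus1)+
  then show "B v w = 0" "B w v = 0" using two_nz by simp_all
qed

text \<open>The eigenspaces of \<open>a\<close> are pairwise orthogonal, so both sides reduce to
  \<open>c * d * B a a + \<eta> * B w w'\<close>.\<close>

lemma form_axis_associative:
  assumes a: "splitting_axis a"
  shows "B (x \<bullet> a) y = B x (a \<bullet> y)"
proof -
  obtain c v w d v' w' where "decomp a x c v w" "decomp a y d v' w'"
    using splitting_axis_decomp[OF a] by meson
  then have v: "v \<bullet> a = 0" "v' \<bullet> a = 0" "w \<bullet> a = \<eta> *s w" "w' \<bullet> a = \<eta> *s w'"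
    and xy: "x = c *s a + v + w" "y = d *s a + v' + w'"
    by (auto simp: decomp_def)
  have "B v a = 0" "B w a = 0" "B a v' = 0" "B a w' = 0"
    using a v by (simp_all add: B_axis form_axis_right phi_eq_0 phi_eq_0_\<eta>)
  moreover have "B v w' = 0" "B w v' = 0" using form_orthogonal[OF a] v by blast+
  ultimately show ?thesis
    by (simp add: mult_commute[of a y])
      (simp add: xy form_simps bilinear_simps v splitting_axis_idem[OF a])
qed

text \<open>Both sides are linear in the middle factor \<open>y\<close>, and the axes span, so the
  case of an axis suffices.\<close>

lemma form_associative: "B (x \<bullet> y) z = B x (y \<bullet> z)"
  by (induction y rule: axes_induct)
    (simp_all add: form_simps form_zero bilinear_simps form_axis_associative)

end

end

end

theorem theorem4p1:
  fixes scale :: "'f::field \<Rightarrow> 'a::ab_group_add \<Rightarrow> 'a"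
    and mult :: "'a \<Rightarrow> 'a \<Rightarrow> 'a"
    and \<eta> :: 'f
  assumes "comm_nonassoc_algebra scale mult"
    and "CHAR('f) \<noteq> 2"
    and "\<eta> \<noteq> 0" and "\<eta> \<noteq> 1"
    and "\<exists>x::'a. x \<noteq> 0"
    and "comm_nonassoc_algebra.is_primitive_axial_of_Jordan_type scale mult \<eta>"
  shows "\<exists>B :: 'a \<Rightarrow> 'a \<Rightarrow> 'f.
    comm_nonassoc_algebra.is_Frobenius_form scale mult B \<and>
    (\<forall>a. comm_nonassoc_algebra.is_axis scale mult \<eta> a \<longrightarrow> B a a = 1)"
proof -
  interpret comm_nonassoc_algebra scale mult by fact
  have "(2::'f) \<noteq> 0"
  proof
    assume "(2::'f) = 0"
    then have "of_nat 2 = (0::'f)" by simp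
    then have dvd: "CHAR('f) dvd 2" by (simp only: of_nat_eq_0_iff_char_dvd)
    then have "CHAR('f) \<le> 2" by (rule dvd_imp_le) simp
    moreover have "CHAR('f) \<noteq> 0" using dvd by (intro notI) simp
    moreover have "CHAR('f) \<noteq> 1" using CHAR_not_1' by simp
    ultimately show False using assms(2) by linarith
  qed
  then interpret jordan_type_algebra scale mult \<eta>
    using assms(3,4) by unfold_locales
  note spanning = span_axes[OF assms(6)]
  obtain B where B: "bilinear_form B" "\<And>a x. splitting_axis a \<Longrightarrow> B a x = phi a x"
    using exists_form[OF spanning] by blast
  have norm: "B a a = 1" if "splitting_axis a" for a
    using B(2)[OF that] phi_self[OF that] by simp
  \<comment> \<open>An axis exists because otherwise the span of the axes, which is the whole
    algebra, would be zero; its norm 1 then shows that the form is nonzero.\<close>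
  obtain a where "splitting_axis a"
  proof (rule ccontr)
    assume "\<not> thesis"
    then have "{a. splitting_axis a} = {}" using that by blast
    then have "span {} = (UNIV :: 'a set)" using spanning by simp
    then show False using assms(5) by auto
  qed
  then have "\<exists>x y. B x y \<noteq> 0" by (metis norm zero_neq_one)
  then have "is_Frobenius_form B"
    using form_associative[OF spanning B] B(1) by (simp add: is_Frobenius_form_def)
  then show ?thesis using norm is_axis_imp_splitting_axis by blast
qed

end
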